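(* Let $n \geq 4$ and $2 \leq j \leq n-2$ be integers. Let $\mathcal{Y}(j,n)$ be the set of standard Young tableaux of shape $(j,2,1^{n-j-2})$, and let $\mathcal{S}(j,n) = \{(W,a) : W \subseteq [n],\ |W| = j,\ a \in m'(W)\}$. Then the function $\phi : \mathcal{Y}(j,n) \to \mathcal{S}(j,n)$ given by $\phi(T) = (W_T, a_T)$ is a bijection. (Here $m'(W)$, $W_T$ and $a_T$ are as defined in the context.)
   Context: Notation: $[n] = \{1,2,\ldots,n\}$. $C_n$ is the cycle graph on vertex set $[n]$ whose edges are all pairs $\{i,k\}$ with $i-k \equiv \pm 1 \pmod n$. For $W \subseteq [n]$, $C_n[W]$ denotes the restriction (induced subgraph) of $C_n$ to the vertices in $W$, and $\overline{W} = [n] \setminus W$. Young tableaux are arranged in left-justified rows of weakly decreasing length with the first (top) row longest. The shape $(j,2,1^{n-j-2})$ has first row of length $j$, second row of length $2$, and $n-j-2$ further rows of length $1$, so it has $n$ boxes in total. A standard Young tableau of this shape is a filling of the boxes by the elements of $[n]$, each used exactly once, with entries strictly increasing along rows (left to right) and down columns (top to bottom). $T(i,k)$ denotes the entry of $T$ in row $i$ (from the top) and column $k$ (from the left). For a subset $W \subseteq [n]$ define $$m(W) = \begin{cases} \{\min(X) : X \text{ is (the vertex set of) a connected component of } C_n[W]\} & \text{if } 1 \notin W,\\ \{\min(X) : X \text{ is (the vertex set of) a connected component of } C_n[\overline{W}]\} & \text{if } 1 \in W,\end{cases}$$ where $\min(X)$ is the smallest label in $X$, and let $m'(W) = m(W)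 \setminus \{\min(m(W))\}$, i.e. $m(W)$ with its smallest element removed. For a standard Young tableau $T \in \mathcal{Y}(j,n)$, let $a_T = T(2,2)$, let $B$ be the box of $T$ that contains the number $a_T - 1$, and set $$W_T = \begin{cases} \{T(1,i) : 1 \leq i \leq j\} & \text{if } B \text{ lies in the first row of } T,\\ \{T(2,2)\} \cup \{T(1,i) : 2 \leq i \leq j\} & \text{if } B \text{ lies in the first column of } T.\end{cases}$$ *)

theory Defs
  imports "Graph_Theory.Graph_Theory" "HOL-Number_Theory.Cong" "HOL-Library.FuncSet"
begin

section \<open>Standard Young tableaux\<close>

text \<open>A shape is the list of its row lengths, top row first. Boxes are pairs (row, column),
  both counted from 1.\<close>

definition young_diagram :: "nat list \<Rightarrow> (nat \<times> nat) set" where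
  "young_diagram shape =
     {(i, k). 1 \<le> i \<and> i \<le> length shape \<and> 1 \<le> k \<and> k \<le> shape ! (i - 1)}"

text \<open>Extensionality makes a tableau determined by its entries in the boxes of the diagram,
  so that distinct functions are distinct tableaux.\<close>

definition standard_young_tableaux :: "nat list \<Rightarrow> (nat \<times> nat \<Rightarrow> nat) set" where
  "standard_young_tableaux shape =
     {T \<in> extensional (young_diagram shape).
        bij_betw T (young_diagram shape) {1..sum_list shape} \<and>
        (\<forall>i k k'. (i, k) \<in> young_diagram shape \<longrightarrow> (i, k') \<in> young_diagram shape \<longrightarrow>
            k < k' \<longrightarrow> T (i, k) < T (i, k')) \<and>
        (\<forall>i i' k. (i, k) \<in> young_diagram shape \<longrightarrow> (i', k) \<in> young_diagram shape \<longrightarrow>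
            i < i' \<longrightarrow> T (i, k) < T (i', k))}"

definition shape_j21 :: "nat \<Rightarrow> nat \<Rightarrow> nat list" where
  "shape_j21 j n = j # 2 # replicate (n - j - 2) 1"

definition Y_set :: "nat \<Rightarrow> nat \<Rightarrow> (nat \<times> nat \<Rightarrow> nat) set" where
  "Y_set j n = standard_young_tableaux (shape_j21 j n)"

section \<open>Induced subgraphs of the cycle\<close>

text \<open>As usual in Graph_Theory, an undirected graph is a symmetric digraph: both
  orientations of every edge are arcs.\<close>

definition cycle_graph :: "nat \<Rightarrow> nat pair_pre_digraph" where
  "cycle_graph n =
     \<lparr> pverts = {1..n},
       parcs = {(i, k). i \<in> {1..n} \<and> k \<in> {1..n} \<and>
                  ([int i - int k = 1] (mod int n) \<or> [int i - int k = - 1] (mod int n))} \<rparr>"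

lemma pair_graph_cycle_graph:
  assumes "n \<ge> 2"
  shows "pair_graph (cycle_graph n)"
proof
  show "finite (parcs (cycle_graph n))"
    by (rule finite_subset[of _ "{1..n} \<times> {1..n}"]) (auto simp: cycle_graph_def)
next
  fix e assume "e \<in> parcs (cycle_graph n)"
  moreover have "\<not> [0 = 1] (mod int n)" "\<not> [0 = - 1] (mod int n)"
    using assms by (auto simp: cong_iff_dvd_diff)
  ultimately show "fst e \<noteq> snd e"
    by (auto simp: cycle_graph_def)
next
  have *: "[b - a = 1] (mod m) \<longleftrightarrow> [a - b = - 1] (mod m)" for a b m :: int
    using cong_minus_minus_iff[of "a - b" "- 1" m] by simp
  show "symmetric (with_proj (cycle_graph n))"
    unfolding symmetric_def by (rule symI) (auto simp: cycle_graph_def *)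
qed (auto simp: cycle_graph_def)

text \<open>Vertex sets of the connected components of the subgraph of the cycle induced by W.
  The graph being symmetric, these are the strongly connected components.\<close>

definition cycle_components :: "nat \<Rightarrow> nat set \<Rightarrow> nat set set" where
  "cycle_components n W = pre_digraph.sccs_verts (with_proj (cycle_graph n) \<restriction> W)"

definition m_set :: "nat \<Rightarrow> nat set \<Rightarrow> nat set" where
  "m_set n W =
     (if 1 \<notin> W then {Min X |X. X \<in> cycle_components n W}
      else {Min X |X. X \<in> cycle_components n ({1..n} - W)})"

definition m'_set :: "nat \<Rightarrow> nat set \<Rightarrow> nat set" where
  "m'_set n W = m_set n W - {Min (m_set n W)}"

definition S_set :: "nat \<Rightarrow> nat \<Rightarrow> (nat set \<times> nat) set" where
  "S_set j n = {(W, a). W \<subseteq> {1..n} \<and> card W = j \<and> a \<in> m'_set n W}"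

section \<open>The map from tableaux to pairs\<close>

definition a_of :: "(nat \<times> nat \<Rightarrow> nat) \<Rightarrow> nat" where
  "a_of T = T (2, 2)"

definition box_B :: "nat \<Rightarrow> nat \<Rightarrow> (nat \<times> nat \<Rightarrow> nat) \<Rightarrow> nat \<times> nat" where
  "box_B j n T = inv_into (young_diagram (shape_j21 j n)) T (a_of T - 1)"

text \<open>The last branch is never taken on a standard tableau: (2,2) is the only box outside the
  first row and the first column, and it contains a, not a - 1. The first two branches do not
  overlap, since the box (1,1) contains 1 and a > 2.\<close>

definition W_of :: "nat \<Rightarrow> nat \<Rightarrow> (nat \<times> nat \<Rightarrow> nat) \<Rightarrow> nat set" where
  "W_of j n T =
     (if fst (box_B j n T) = 1 then {T (1, i) |i. 1 \<le> i \<and> i \<le> j}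
      else if snd (box_B j n T) = 1 then {T (2, 2)} \<union> {T (1, i) |i. 2 \<le> i \<and> i \<le> j}
      else undefined)"

definition phi :: "nat \<Rightarrow> nat \<Rightarrow> (nat \<times> nat \<Rightarrow> nat) \<Rightarrow> nat set \<times> nat" where
  "phi j n T = (W_of j n T, a_of T)"

end

theory Submission
  imports Defs
begin

text \<open>
  Two observations turn the theorem into a statement about subsets of \<open>{1..n}\<close>.

  The subset side. A set \<open>V\<close> that avoids the vertex 1 does not use the wrap-around edge of the
  cycle, so the components of the induced graph are the maximal intervals of \<open>V\<close>, and their
  minima are the elements of \<open>V\<close> whose predecessor is outside \<open>V\<close>. Hence \<open>(W, a)\<close> is a valid
  pair exactly when \<open>a\<close> is on the other side of \<open>W\<close> than 1, \<open>a - 1\<close> is on the same side as 1, and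
  some element smaller than \<open>a\<close> is on the other side too (\<open>mem_m'_set_iff\<close>).

  The tableau side. A tableau of shape \<open>(j, 2, 1, ..., 1)\<close> is a hook with one additional box
  \<open>(2,2)\<close>. It is determined by the set \<open>R\<close> of entries of its first row and by \<open>a = T (2,2)\<close>:
  sorting \<open>R\<close> gives the row, and sorting the remaining numbers together with 1 gives the first
  column. The only further condition is that \<open>a\<close> exceeds its two neighbours \<open>T (1,2)\<close> and
  \<open>T (2,1)\<close>, which means that besides 1 some element of \<open>R\<close> and some non-element of \<open>R\<close> are smaller
  than \<open>a\<close> (\<open>bij_betw_row_and_corner\<close>).

  In these terms the map of the theorem keeps \<open>R\<close> if \<open>a - 1 \<in> R\<close> and exchanges 1 for \<open>a\<close>
  otherwise. Either way \<open>a - 1\<close> and 1 end up on the same side and \<open>a\<close> on the other. Of the two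
  conditions on small elements, one is witnessed by \<open>a - 1\<close> itself and the other becomes the
  condition that \<open>a\<close> is not the smallest element of \<open>m(W)\<close>. Whether 1 belongs to \<open>W\<close> tells which of the two
  rules was used, so the exchange can be undone (\<open>bij_betw_exchange\<close>).
\<close>

section \<open>Minima of the components of an induced subgraph of the cycle\<close>

lemma arc_cycle_graph_iff:
  assumes "u \<in> {2..n}" "v \<in> {2..n}"
  shows "(u, v) \<in> parcs (cycle_graph n) \<longleftrightarrow> u = v + 1 \<or> v = u + 1"
proof -
  \<comment> \<open>Away from the vertex 1, differences have absolute value at most \<open>n - 2\<close>, too small for a
    congruence with \<open>1\<close> or \<open>- 1\<close> to hold without equality.\<close>
  have cong_1: "[x = 1] (mod int n) \<longleftrightarrow> x = 1" if "\<bar>x\<bar> \<le> int n - 2" for x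
  proof
    assume "[x = 1] (mod int n)"
    then have "int n dvd x - 1"
      by (simp add: cong_iff_dvd_diff)
    moreover have "\<bar>x - 1\<bar> < int n"
      using that by linarith
    ultimately show "x = 1"
      using zdvd_imp_le[of "int n" "\<bar>x - 1\<bar>"] by auto
  qed auto
  have cong_m1: "[x = - 1] (mod int n) \<longleftrightarrow> x = - 1" if "\<bar>x\<bar> \<le> int n - 2" for x
    using cong_1[of "- x"] cong_minus_minus_iff[of "- x" 1 "int n"] that by auto
  have "\<bar>int u - int v\<bar> \<le> int n - 2"
    using assms by auto
  then show ?thesis
    using assms cong_1 cong_m1 by (auto simp: cycle_graph_def)
qed

text \<open>A minimum \<open>m\<close> of a component cannot have \<open>m - 1 \<in> V\<close>, since \<open>m - 1\<close> would then belong to the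
  same component. Conversely, if \<open>v - 1 \<notin> V\<close>, nothing below \<open>v\<close> can be reached from \<open>v\<close>. The only
  other way down would be the edge from \<open>n\<close> to 1, and \<open>1 \<notin> V\<close>.\<close>

lemma minima_of_cycle_components:
  assumes V: "V \<subseteq> {2..n}"
  shows "{Min X |X. X \<in> cycle_components n V} = {v \<in> V. v - 1 \<notin> V}"
proof -
  let ?G = "with_proj (cycle_graph n) \<restriction> V"
  interpret G: wf_digraph ?G
    by unfold_locales auto
  have arc: "u \<rightarrow>\<^bsub>?G\<^esub> v \<longleftrightarrow> u \<in> V \<and> v \<in> V \<and> (u = v + 1 \<or> v = u + 1)" for u v
  proof -
    have "u \<rightarrow>\<^bsub>?G\<^esub> v \<longleftrightarrow> u \<in> V \<and> v \<in> V \<and> (u, v) \<in> parcs (cycle_graph n)"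
      by (force simp: arcs_ends_conv)
    then show ?thesis
      using arc_cycle_graph_iff[of u n v] V by blast
  qed
  have comps: "cycle_components n V = G.scc_of ` V"
    unfolding cycle_components_def using G.sccs_verts_conv_scc_of by simp
  have scc_subset: "G.scc_of u \<subseteq> V" for u
    by (auto simp: G.scc_of_def dest: G.reachable_in_verts)
  then have fin: "finite (G.scc_of u)" for u
    using V finite_subset by (metis finite_atLeastAtMost)
  have self: "u \<in> G.scc_of u" if "u \<in> V" for u
    using that G.in_scc_of_self by simp
  show ?thesis
  proof (intro equalityI subsetI)
    fix m assume "m \<in> {Min X |X. X \<in> cycle_components n V}"
    then obtain u where u: "u \<in> V" and m: "m = Min (G.scc_of u)"
      by (auto simp: comps)
    have m_in: "m \<in> G.scc_of u"
      unfolding m using fin self[OF u] by (intro Min_in) auto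
    have "m - 1 \<notin> V"
    proof
      assume pred: "m - 1 \<in> V"
      have "m \<in> V"
        using m_in scc_subset by blast
      then have "m \<ge> 2"
        using V by auto
      then have adj: "m \<rightarrow>\<^bsub>?G\<^esub> (m - 1)" "(m - 1) \<rightarrow>\<^bsub>?G\<^esub> m"
        using pred \<open>m \<in> V\<close> by (auto simp: arc)
      then have "m - 1 \<in> G.scc_of u"
        using m_in unfolding G.scc_of_def
        by (auto intro: G.reachable_adj_trans G.adj_reachable_trans)
      then have "m \<le> m - 1"
        unfolding m using fin by simp
      then show False
        using \<open>m \<ge> 2\<close> by simp
    qed
    then show "m \<in> {v \<in> V. v - 1 \<notin> V}"
      using m_in scc_subset by blast
  next
    fix v assume v: "v \<in> {v \<in> V. v - 1 \<notin> V}"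
    \<comment> \<open>A path inside \<open>V\<close> moves in unit steps, so it could only get below \<open>v\<close> through \<open>v - 1\<close>.\<close>
    have ge: "w \<ge> v" if "v \<rightarrow>\<^sup>*\<^bsub>?G\<^esub> w" for w
      using that
    proof (induction rule: G.reachable_induct)
      case base
      then show ?case by simp
    next
      case (step x y)
      then have "y \<noteq> v - 1" "x = y + 1 \<or> y = x + 1"
        using v by (auto simp: arc)
      with step show ?case by linarith
    qed
    then have "Min (G.scc_of v) = v"
      using v self fin by (intro Min_eqI) (auto simp: G.scc_of_def)
    then show "v \<in> {Min X |X. X \<in> cycle_components n V}"
      using v comps by (metis (mono_tags, lifting) image_eqI mem_Collect_eq)
  qed
qed

text \<open>Both cases of the definition of \<open>m(W)\<close> concern the side \<open>V\<close> of the partition \<open>{W, {1..n} - W}\<close>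
  that does not contain 1, which makes the description uniform. The least element of \<open>m(W)\<close> is the
  least element of \<open>V\<close>, so an \<open>a\<close> in \<open>m(W)\<close> survives its removal if and only if \<open>V\<close> has an element
  below \<open>a\<close>.\<close>

lemma mem_m'_set_iff:
  assumes W: "W \<subseteq> {1..n}"
  shows "a \<in> m'_set n W \<longleftrightarrow>
    a \<in> {2..n} \<and> (a \<in> W \<longleftrightarrow> 1 \<notin> W) \<and> (a - 1 \<in> W \<longleftrightarrow> 1 \<in> W) \<and>
    (\<exists>c\<in>{2..<a}. c \<in> W \<longleftrightarrow> 1 \<notin> W)"
proof -
  define V where "V = {v \<in> {2..n}. v \<in> W \<longleftrightarrow> 1 \<notin> W}"
  define M where "M = {v \<in> V. v - 1 \<notin> V}"
  have V_sub: "V \<subseteq> {2..n}"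
    by (auto simp: V_def)
  have "V = (if 1 \<notin> W then W else {1..n} - W)"
  proof (intro set_eqI)
    fix x
    have "x \<in> {2..n} \<longleftrightarrow> x \<in> {1..n} \<and> x \<noteq> 1"
      by auto
    then show "x \<in> V \<longleftrightarrow> x \<in> (if 1 \<notin> W then W else {1..n} - W)"
      using W unfolding V_def by auto
  qed
  then have m: "m_set n W = M"
    using minima_of_cycle_components[OF V_sub] by (auto simp: m_set_def M_def split: if_splits)
  have "finite V"
    using V_sub finite_subset by blast
  then have fin: "finite M"
    by (simp add: M_def)
  have Min_in_M: "Min V \<in> M" if "V \<noteq> {}"
  proof -
    have "Min V \<in> V"
      using \<open>finite V\<close> that by simp
    moreover have "Min V - 1 \<notin> V"
    proof
      assume "Min V - 1 \<in> V"
      then have "Min V \<le> Min V - 1" "Min V \<ge> 2"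
        using \<open>finite V\<close> \<open>Min V \<in> V\<close> V_sub by auto
      then show False by simp
    qed
    ultimately show ?thesis by (simp add: M_def)
  qed
  have not_least: "a \<noteq> Min M \<longleftrightarrow> (\<exists>c\<in>V. c < a)" if a: "a \<in> M"
  proof -
    have ne: "V \<noteq> {}"
      using a by (auto simp: M_def)
    have "Min M = Min V"
      using Min_in_M[OF ne] \<open>finite V\<close> fin by (intro Min_eqI) (auto simp: M_def)
    moreover have "a \<ge> Min V"
      using a \<open>finite V\<close> by (auto simp: M_def)
    ultimately have "a \<noteq> Min M \<longleftrightarrow> Min V < a"
      by auto
    then show ?thesis
      using Min_less_iff[OF \<open>finite V\<close> ne] by simp
  qed
  have "a \<in> m'_set n W \<longleftrightarrow> a \<in> M \<and> (\<exists>c\<in>V. c < a)"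
    using not_least by (auto simp: m'_set_def m)
  also have "\<dots> \<longleftrightarrow> a \<in> {2..n} \<and> (a \<in> W \<longleftrightarrow> 1 \<notin> W) \<and> (a - 1 \<in> W \<longleftrightarrow> 1 \<in> W) \<and>
    (\<exists>c\<in>{2..<a}. c \<in> W \<longleftrightarrow> 1 \<notin> W)" (is "_ \<longleftrightarrow> ?rhs")
  proof
    assume L: "a \<in> M \<and> (\<exists>c\<in>V. c < a)"
    then obtain c where c: "c \<in> V" "c < a" by blast
    then have "c \<in> {2..<a}" "c \<in> W \<longleftrightarrow> 1 \<notin> W"
      by (auto simp: V_def)
    moreover from c L have "a - 1 \<in> {2..n}"
      by (auto simp: M_def V_def)
    ultimately show ?rhs
      using L unfolding M_def V_def by blast
  next
    assume R: ?rhs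
    then obtain c where "c \<in> {2..<a}" "c \<in> W \<longleftrightarrow> 1 \<notin> W" by blast
    then have "c \<in> V" "c < a"
      using R by (auto simp: V_def)
    then show "a \<in> M \<and> (\<exists>c\<in>V. c < a)"
      using R unfolding M_def V_def by blast
  qed
  finally show ?thesis .
qed

section \<open>Increasing enumerations\<close>

text \<open>Enumerations start at index 1, to agree with the numbering of rows and columns.\<close>

lemma ex_increasing_enumeration:
  fixes A :: "nat set"
  assumes "finite A"
  obtains f where "strict_mono_on {1..card A} f" "f ` {1..card A} = A"
proof
  let ?xs = "sorted_list_of_set A"
  let ?f = "\<lambda>i. ?xs ! (i - 1)"
  have len: "length ?xs = card A"
    using assms by simp
  show "strict_mono_on {1..card A} ?f"
  proof (rule strict_mono_onI)
    fix r s assume "r \<in> {1..card A}" "s \<in> {1..card A}" "r < s"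
    then show "?f r < ?f s"
      using sorted_wrt_nth_less[OF strict_sorted_list_of_set[of A], of "r - 1" "s - 1"] len
      by auto
  qed
  have "?f ` {1..card A} = (\<lambda>i. ?xs ! i) ` {0..<card A}"
  proof -
    have "(\<lambda>i. i - 1) ` {1..card A} = {0..<card A}"
      by force
    then show ?thesis
      by (metis (no_types, lifting) image_cong image_image)
  qed
  also have "\<dots> = set ?xs"
    using nth_image[of "card A" ?xs] len by simp
  finally show "?f ` {1..card A} = A"
    using assms by simp
qed

lemma increasing_enumeration_unique:
  fixes f g :: "nat \<Rightarrow> nat"
  assumes f: "strict_mono_on {1..m} f" and g: "strict_mono_on {1..m} g"
    and same: "f ` {1..m} = g ` {1..m}" and i: "i \<in> {1..m}"
  shows "f i = g i"
proof -
  have sorted: "sorted_wrt (<) (map h [1..<Suc m])" if "strict_mono_on {1..m} h" for h :: "nat \<Rightarrow> nat"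
    using that unfolding sorted_wrt_map
    by (intro sorted_wrt_mono_rel[OF _ sorted_wrt_upt]) (auto simp: strict_mono_on_def)
  have "map f [1..<Suc m] = map g [1..<Suc m]"
    using sorted[OF f] sorted[OF g] same
    by (intro strict_sorted_equal) (auto simp: atLeastLessThanSuc_atLeastAtMost simp del: upt_Suc)
  then have "\<forall>i\<in>set [1..<Suc m]. f i = g i"
    by (simp only: map_eq_conv)
  moreover have "i \<in> set [1..<Suc m]"
    using i by auto
  ultimately show ?thesis by blast
qed

lemma increasing_enumeration_first:
  fixes f :: "nat \<Rightarrow> nat"
  assumes f: "strict_mono_on {1..m} f" and least: "x \<in> f ` {1..m}" "\<And>y. y \<in> f ` {1..m} \<Longrightarrow> x \<le> y"
  shows "f 1 = x"
proof -
  obtain i where i: "i \<in> {1..m}" "x = f i"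
    using least by blast
  then have "f 1 \<le> f i"
    using strict_mono_on_leD[OF f, of 1 i] by auto
  moreover have "x \<le> f 1"
    using i by (intro least) auto
  ultimately show ?thesis
    using i by simp
qed

section \<open>Tableaux of near-hook shape\<close>

abbreviation near_hook :: "nat \<Rightarrow> nat \<Rightarrow> (nat \<times> nat) set" where
  "near_hook j n \<equiv> {1} \<times> {1..j} \<union> {1..n - j} \<times> {1} \<union> {(2, 2)}"

lemma young_diagram_shape_j21:
  assumes "2 \<le> j" "j + 2 \<le> n"
  shows "young_diagram (shape_j21 j n) = near_hook j n"
proof -
  have row: "shape_j21 j n ! (i - 1) = (if i = 1 then j else if i = 2 then 2 else 1)"
    if "1 \<le> i" "i \<le> n - j" for i
  proof (cases "i \<le> 2")
    case True
    then have "i = 1 \<or> i = 2"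
      using that by auto
    then show ?thesis
      by (auto simp: shape_j21_def)
  next
    case False
    then have "i - 1 = Suc (Suc (i - 3))" "i - 3 < n - j - 2"
      using that by auto
    then show ?thesis
      using False by (simp add: shape_j21_def)
  qed
  have len: "length (shape_j21 j n) = n - j"
    using assms by (simp add: shape_j21_def)
  have "(i, k) \<in> young_diagram (shape_j21 j n) \<longleftrightarrow>
    1 \<le> i \<and> i \<le> n - j \<and> 1 \<le> k \<and> k \<le> (if i = 1 then j else if i = 2 then 2 else 1)" for i k
    using row[of i] by (auto simp: young_diagram_def len)
  then show ?thesis
    using assms by (auto split: if_splits)
qed

lemma Y_set_iff:
  assumes "2 \<le> j" "j + 2 \<le> n"
  shows "T \<in> Y_set j n \<longleftrightarrow>
    T \<in> extensional (near_hook j n) \<and> bij_betw T (near_hook j n) {1..n} \<and>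
    strict_mono_on {1..j} (\<lambda>k. T (1, k)) \<and> strict_mono_on {1..n - j} (\<lambda>i. T (i, 1)) \<and>
    T (1, 2) < T (2, 2) \<and> T (2, 1) < T (2, 2)" (is "_ \<longleftrightarrow> ?rhs")
proof -
  let ?D = "near_hook j n"
  have sum: "sum_list (shape_j21 j n) = n"
    using assms by (simp add: shape_j21_def sum_list_replicate)
  have Y: "T \<in> Y_set j n \<longleftrightarrow> T \<in> extensional ?D \<and> bij_betw T ?D {1..n} \<and>
    (\<forall>i k k'. (i, k) \<in> ?D \<longrightarrow> (i, k') \<in> ?D \<longrightarrow> k < k' \<longrightarrow> T (i, k) < T (i, k')) \<and>
    (\<forall>i i' k. (i, k) \<in> ?D \<longrightarrow> (i', k) \<in> ?D \<longrightarrow> i < i' \<longrightarrow> T (i, k) < T (i', k))"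
    (is "_ \<longleftrightarrow> _ \<and> _ \<and> ?rows \<and> ?cols")
    unfolding Y_set_def standard_young_tableaux_def young_diagram_shape_j21[OF assms] sum by simp
  have rows_iff: "?rows \<longleftrightarrow> strict_mono_on {1..j} (\<lambda>k. T (1, k)) \<and> T (2, 1) < T (2, 2)"
  proof
    assume rows: ?rows
    have "strict_mono_on {1..j} (\<lambda>k. T (1, k))"
      using rows by (intro strict_mono_onI) auto
    moreover have "T (2, 1) < T (2, 2)"
      using rows[rule_format, of 2 1 2] assms by auto
    ultimately show "strict_mono_on {1..j} (\<lambda>k. T (1, k)) \<and> T (2, 1) < T (2, 2)"
      by blast
  qed (auto simp: strict_mono_on_def)
  have cols_iff: "?cols \<longleftrightarrow> strict_mono_on {1..n - j} (\<lambda>i. T (i, 1)) \<and> T (1, 2) < T (2, 2)"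
  proof
    assume cols: ?cols
    have "strict_mono_on {1..n - j} (\<lambda>i. T (i, 1))"
      using cols by (intro strict_mono_onI) auto
    moreover have "T (1, 2) < T (2, 2)"
      using cols[rule_format, of 1 2 2] assms by auto
    ultimately show "strict_mono_on {1..n - j} (\<lambda>i. T (i, 1)) \<and> T (1, 2) < T (2, 2)"
      by blast
  qed (auto simp: strict_mono_on_def)
  show ?thesis
    unfolding Y rows_iff cols_iff by (simp only: conj_ac)
qed

definition first_row :: "nat \<Rightarrow> (nat \<times> nat \<Rightarrow> nat) \<Rightarrow> nat set" where
  "first_row j T = (\<lambda>k. T (1, k)) ` {1..j}"

text \<open>The last two conditions express \<open>T (1,2) < a\<close> and \<open>T (2,1) < a\<close> without reference to \<open>T\<close>:
  \<open>T (1,2)\<close> is the least element of \<open>R - {1}\<close>, and \<open>T (2,1)\<close> is the least element of the rest of the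
  first column. Since a witness \<open>c\<close> is smaller than \<open>a\<close>, it differs from \<open>a\<close> and hence lies in that
  column.\<close>

definition row_corner_pairs :: "nat \<Rightarrow> nat \<Rightarrow> (nat set \<times> nat) set" where
  "row_corner_pairs j n =
     {(R, a). R \<subseteq> {1..n} \<and> card R = j \<and> 1 \<in> R \<and> a \<in> {1..n} - R \<and>
        (\<exists>r\<in>{2..<a}. r \<in> R) \<and> (\<exists>c\<in>{2..<a}. c \<notin> R)}"

text \<open>The box \<open>(1,1)\<close> holds the minimum, as every other box is preceded by it in a chain of rows and
  columns. Bijectivity then leaves to the first column exactly the numbers outside the first row and
  the corner, besides the shared entry 1.\<close>

lemma tableau_facts:
  assumes j: "2 \<le> j" "j + 2 \<le> n" and T: "T \<in> Y_set j n"
  shows "T (1, 1) = 1"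
    and "(\<lambda>i. T (i, 1)) ` {1..n - j} = insert 1 ({1..n} - first_row j T - {T (2, 2)})"
    and "(first_row j T, T (2, 2)) \<in> row_corner_pairs j n"
proof -
  let ?D = "near_hook j n"
  have bij: "bij_betw T ?D {1..n}" and row: "strict_mono_on {1..j} (\<lambda>k. T (1, k))"
    and col: "strict_mono_on {1..n - j} (\<lambda>i. T (i, 1))"
    and nbrs: "T (1, 2) < T (2, 2)" "T (2, 1) < T (2, 2)"
    using T unfolding Y_set_iff[OF j] by auto
  have inj: "inj_on T ?D" and img: "T ` ?D = {1..n}"
    using bij by (auto simp: bij_betw_def)
  have row1: "T (1, 1) < T (1, k)" if "k \<in> {2..j}" for k
    using strict_mono_onD[OF row, of 1 k] that j by auto
  have col1: "T (1, 1) < T (i, 1)" if "i \<in> {2..n - j}" for i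
    using strict_mono_onD[OF col, of 1 i] that j by auto
  have le: "T (1, 1) \<le> T b" if "b \<in> ?D" for b
  proof -
    have "b = (1, 1) \<or> b = (2, 2) \<or> (\<exists>k\<in>{2..j}. b = (1, k)) \<or> (\<exists>i\<in>{2..n - j}. b = (i, 1))"
      using that by force
    moreover have "T (1, 1) < T (2, 2)"
      using row1[of 2] nbrs j by auto
    ultimately show ?thesis
      using row1 col1 by (auto intro: less_imp_le)
  qed
  have "1 \<in> T ` ?D"
    using img j by auto
  then obtain b where "b \<in> ?D" "1 = T b"
    by (rule imageE)
  then have "T (1, 1) \<le> 1"
    using le[of b] by simp
  moreover have "T (1, 1) \<in> {1..n}"
    unfolding img[symmetric] using j by (intro imageI) auto
  ultimately show T11: "T (1, 1) = 1"
    by auto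
  have notin: "T (i, 1) \<notin> first_row j T" if "i \<in> {2..n - j}" for i
  proof
    assume "T (i, 1) \<in> first_row j T"
    then obtain k where "k \<in> {1..j}" "T (i, 1) = T (1, k)"
      by (auto simp: first_row_def)
    then have "(i, 1) = (1, k)"
      using that by (intro inj_onD[OF inj]) auto
    then show False
      using that by auto
  qed
  have a_notin: "T (2, 2) \<notin> first_row j T"
  proof
    assume "T (2, 2) \<in> first_row j T"
    then obtain k where "k \<in> {1..j}" "T (2, 2) = T (1, k)"
      by (auto simp: first_row_def)
    then have "(2, 2) = (1::nat, k)"
      by (intro inj_onD[OF inj]) auto
    then show False by simp
  qed
  have a_notin_col: "T (2, 2) \<noteq> T (i, 1)" if "i \<in> {1..n - j}" for i
  proof
    assume "T (2, 2) = T (i, 1)"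
    then have "(2, 2) = (i, 1::nat)"
      using that by (intro inj_onD[OF inj]) auto
    then show False by simp
  qed
  have "T ` ?D = first_row j T \<union> (\<lambda>i. T (i, 1)) ` {1..n - j} \<union> {T (2, 2)}"
    by (auto simp: first_row_def)
  then have union: "{1..n} = first_row j T \<union> (\<lambda>i. T (i, 1)) ` {1..n - j} \<union> {T (2, 2)}"
    using img by simp
  show "(\<lambda>i. T (i, 1)) ` {1..n - j} = insert 1 ({1..n} - first_row j T - {T (2, 2)})"
  proof (intro equalityI subsetI)
    fix x assume "x \<in> (\<lambda>i. T (i, 1)) ` {1..n - j}"
    then obtain i where i: "i \<in> {1..n - j}" "x = T (i, 1)" by blast
    show "x \<in> insert 1 ({1..n} - first_row j T - {T (2, 2)})"
    proof (cases "i = 1")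
      case True
      then show ?thesis using i T11 by simp
    next
      case False
      then have "i \<in> {2..n - j}" using i by auto
      then show ?thesis
        using i union notin a_notin_col[of i] by auto
    qed
  next
    fix x assume "x \<in> insert 1 ({1..n} - first_row j T - {T (2, 2)})"
    moreover have "1 \<in> (\<lambda>i. T (i, 1)) ` {1..n - j}"
      using T11 j by (intro image_eqI[of _ _ 1]) auto
    ultimately show "x \<in> (\<lambda>i. T (i, 1)) ` {1..n - j}"
      using union by auto
  qed
  have "card (first_row j T) = j"
    unfolding first_row_def using row by (simp add: card_image strict_mono_on_imp_inj_on)
  moreover have "1 \<in> first_row j T"
    unfolding first_row_def using T11 j by (intro image_eqI[of _ _ 1]) auto
  moreover have two: "2 \<in> {2..j}" "2 \<in> {2..n - j}"
    using j by auto
  then have "T (1, 2) \<in> {2..<T (2, 2)}" "T (2, 1) \<in> {2..<T (2, 2)}"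
    using row1[of 2] col1[of 2] T11 nbrs by auto
  moreover have "T (1, 2) \<in> first_row j T" "T (2, 1) \<notin> first_row j T"
    using j notin[OF two(2)] by (auto simp: first_row_def)
  ultimately show "(first_row j T, T (2, 2)) \<in> row_corner_pairs j n"
    using union a_notin unfolding row_corner_pairs_def by blast
qed

text \<open>The row is the sorted list of \<open>R\<close>, and the column is the sorted list of the remaining numbers
  together with 1. This gives injectivity. For surjectivity the same recipe defines the tableau. Both
  lists begin with 1, so they agree in the box \<open>(1,1)\<close> that they share.\<close>

lemma bij_betw_row_and_corner:
  assumes j: "2 \<le> j" "j + 2 \<le> n"
  shows "bij_betw (\<lambda>T. (first_row j T, T (2, 2))) (Y_set j n) (row_corner_pairs j n)"
  unfolding bij_betw_def
proof (intro conjI equalityI subsetI)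
  let ?D = "near_hook j n"
  show "inj_on (\<lambda>T. (first_row j T, T (2, 2))) (Y_set j n)"
  proof (rule inj_onI)
    fix T T' assume T: "T \<in> Y_set j n" and T': "T' \<in> Y_set j n"
      and "(first_row j T, T (2, 2)) = (first_row j T', T' (2, 2))"
    then have R: "first_row j T = first_row j T'" and a: "T (2, 2) = T' (2, 2)"
      by auto
    have row: "T (1, k) = T' (1, k)" if "k \<in> {1..j}" for k
      using T T' R that unfolding Y_set_iff[OF j] first_row_def
      by (intro increasing_enumeration_unique[of j "\<lambda>k. T (1, k)" "\<lambda>k. T' (1, k)" k]) auto
    have "(\<lambda>i. T (i, 1)) ` {1..n - j} = (\<lambda>i. T' (i, 1)) ` {1..n - j}"
      using tableau_facts(2)[OF j T] tableau_facts(2)[OF j T'] R a by simp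
    then have col: "T (i, 1) = T' (i, 1)" if "i \<in> {1..n - j}" for i
      using T T' that unfolding Y_set_iff[OF j]
      by (intro increasing_enumeration_unique[of "n - j" "\<lambda>i. T (i, 1)" "\<lambda>i. T' (i, 1)" i]) auto
    show "T = T'"
    proof (rule extensionalityI)
      show "T \<in> extensional ?D" "T' \<in> extensional ?D"
        using T T' unfolding Y_set_iff[OF j] by auto
      show "T b = T' b" if "b \<in> ?D" for b
        using that row col a by auto
    qed
  qed
next
  fix p assume "p \<in> (\<lambda>T. (first_row j T, T (2, 2))) ` Y_set j n"
  then show "p \<in> row_corner_pairs j n"
    using tableau_facts(3)[OF j] by auto
next
  fix p assume p: "p \<in> row_corner_pairs j n"
  let ?D = "near_hook j n"
  obtain R a r c where p_eq: "p = (R, a)" and R: "R \<subseteq> {1..n}" "card R = j" "1 \<in> R"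
    and a: "a \<in> {1..n}" "a \<notin> R" and r: "r \<in> {2..<a}" "r \<in> R" and c: "c \<in> {2..<a}" "c \<notin> R"
    using p by (auto simp: row_corner_pairs_def)
  define C where "C = insert 1 ({1..n} - R - {a})"
  have finR: "finite R"
    using R finite_subset by blast
  have "card ({1..n} - R - {a}) = n - j - 1"
    using R a finR by (simp add: card_Diff_subset)
  then have card_C: "card C = n - j"
    using R j by (simp add: C_def)
  obtain f where f: "strict_mono_on {1..j} f" "f ` {1..j} = R"
    using ex_increasing_enumeration[OF finR] R by metis
  obtain g where g: "strict_mono_on {1..n - j} g" "g ` {1..n - j} = C"
    using ex_increasing_enumeration[of C] card_C by (auto simp: C_def)
  have "f 1 = 1"
    using f R by (intro increasing_enumeration_first[of j]) auto
  have "g 1 = 1"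
    using g by (intro increasing_enumeration_first[of "n - j"]) (auto simp: C_def)
  define T where
    "T = (\<lambda>b\<in>?D. if fst b = 1 then f (snd b) else if snd b = 1 then g (fst b) else a)"
  have T_row: "T (1, k) = f k" if "k \<in> {1..j}" for k
    using that by (auto simp: T_def)
  have T_col: "T (i, 1) = g i" if "i \<in> {1..n - j}" for i
    using that j \<open>f 1 = 1\<close> \<open>g 1 = 1\<close> by (auto simp: T_def)
  have T_corner: "T (2, 2) = a"
    by (auto simp: T_def)
  have first_row_T: "first_row j T = R"
    unfolding first_row_def f(2)[symmetric] using T_row by (intro image_cong) auto
  have col_T: "(\<lambda>i. T (i, 1)) ` {1..n - j} = C"
    unfolding g(2)[symmetric] using T_col by (intro image_cong) auto
  have "T ` ?D = first_row j T \<union> (\<lambda>i. T (i, 1)) ` {1..n - j} \<union> {T (2, 2)}"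
    by (auto simp: first_row_def)
  also have "\<dots> = {1..n}"
    unfolding first_row_T col_T T_corner using R a by (auto simp: C_def)
  finally have img: "T ` ?D = {1..n}" .
  \<comment> \<open>The diagram has \<open>n\<close> boxes, so a surjection onto \<open>n\<close> values is a bijection.\<close>
  have "card ?D = n"
  proof -
    have "?D = {1} \<times> {1..j} \<union> {2..n - j} \<times> {1} \<union> {(2, 2)}"
      using j by force
    moreover have "card ({1::nat} \<times> {1..j} \<union> {2..n - j} \<times> {1::nat}) = j + (n - j - 1)"
      by (subst card_Un_disjoint) (auto simp: card_cartesian_product)
    moreover have "(2, 2) \<notin> {1::nat} \<times> {1..j} \<union> {2..n - j} \<times> {1::nat}"
      by auto
    ultimately show ?thesis
      using j by simp
  qed
  then have "inj_on T ?D"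
    using img by (intro eq_card_imp_inj_on) auto
  have second: "h 2 \<le> x" if h: "strict_mono_on {1..m} h" "x \<in> h ` {1..m}" and x: "h 1 < x"
    for h :: "nat \<Rightarrow> nat" and m x
  proof -
    obtain i where i: "i \<in> {1..m}" "x = h i"
      using h by blast
    with x have "i \<noteq> 1"
      by auto
    with i show ?thesis
      using strict_mono_on_leD[OF h(1), of 2 i] by auto
  qed
  have "f 2 \<le> r"
    using second[OF f(1), of r] f r \<open>f 1 = 1\<close> by auto
  moreover have "g 2 \<le> c"
    using second[OF g(1), of c] g c a \<open>g 1 = 1\<close> by (auto simp: C_def)
  ultimately have "T (1, 2) < T (2, 2)" "T (2, 1) < T (2, 2)"
    using T_row[of 2] T_col[of 2] T_corner j r c by auto
  moreover have "strict_mono_on {1..j} (\<lambda>k. T (1, k))"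
    using f(1) T_row by (simp add: strict_mono_on_def)
  moreover have "strict_mono_on {1..n - j} (\<lambda>i. T (i, 1))"
    using g(1) T_col by (simp add: strict_mono_on_def)
  moreover have "T \<in> extensional ?D"
    unfolding T_def by (rule restrict_extensional)
  ultimately have "T \<in> Y_set j n"
    unfolding Y_set_iff[OF j] using img \<open>inj_on T ?D\<close> by (simp add: bij_betw_def)
  then show "p \<in> (\<lambda>T. (first_row j T, T (2, 2))) ` Y_set j n"
    using first_row_T T_corner p_eq by force
qed

section \<open>Exchanging 1 for the corner entry\<close>

definition exchange :: "nat set \<times> nat \<Rightarrow> nat set \<times> nat" where
  "exchange = (\<lambda>(R, a). (if a - 1 \<in> R then R else insert a (R - {1}), a))"

text \<open>Since \<open>1 \<in> R\<close> and \<open>a \<notin> R\<close>, the exchange preserves the cardinality and removes 1. So \<open>1 \<in> W\<close> holds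
  exactly when nothing was exchanged, and the inverse map can decide by this test what to undo.\<close>

lemma bij_betw_exchange:
  "bij_betw exchange (row_corner_pairs j n) (S_set j n)"
proof -
  let ?back = "\<lambda>(W, a). (if 1 \<in> W then W else insert 1 (W - {a}), a) :: nat set \<times> nat"
  have to_S: "exchange p \<in> S_set j n \<and> ?back (exchange p) = p"
    if p: "p \<in> row_corner_pairs j n" for p
  proof -
    obtain R a r c where p_eq: "p = (R, a)" and R: "R \<subseteq> {1..n}" "card R = j" "1 \<in> R"
      and a: "a \<in> {1..n}" "a \<notin> R" and r: "r \<in> {2..<a}" "r \<in> R" and c: "c \<in> {2..<a}" "c \<notin> R"
      using p by (auto simp: row_corner_pairs_def)
    have finR: "finite R"
      using R finite_subset by blast
    have a2: "a \<in> {2..n}" "a \<noteq> 1" "r \<noteq> 1" "r \<noteq> a"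
      using a r by auto
    show ?thesis
    proof (cases "a - 1 \<in> R")
      case True
      then have "a \<in> m'_set n R"
        using R a2 a c unfolding mem_m'_set_iff[OF R(1)] by blast
      then show ?thesis
        using True R p_eq by (auto simp: exchange_def S_set_def)
    next
      case False
      let ?W = "insert a (R - {1})"
      have W: "?W \<subseteq> {1..n}"
        using R a by auto
      have "a - 1 \<noteq> a"
        using a by auto
      then have "a \<in> m'_set n ?W"
        using False R a2 r unfolding mem_m'_set_iff[OF W] by blast
      moreover have "card ?W = j"
        using R a finR by (metis DiffD1 card_Suc_Diff1 card_insert_disjoint finite_Diff)
      ultimately have "exchange p \<in> S_set j n"
        using False W p_eq by (auto simp: exchange_def S_set_def)
      moreover have "insert 1 (?W - {a}) = R"
        using R a by auto
      ultimately show ?thesis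
        using False a2 p_eq by (auto simp: exchange_def)
    qed
  qed
  have from_S: "?back q \<in> row_corner_pairs j n \<and> exchange (?back q) = q"
    if q: "q \<in> S_set j n" for q
  proof -
    obtain W a where q_eq: "q = (W, a)" and W: "W \<subseteq> {1..n}" "card W = j"
      and m: "a \<in> m'_set n W"
      using q by (auto simp: S_set_def)
    from m obtain c where a: "a \<in> {2..n}" "a \<in> W \<longleftrightarrow> 1 \<notin> W" "a - 1 \<in> W \<longleftrightarrow> 1 \<in> W"
      and c: "c \<in> {2..<a}" "c \<in> W \<longleftrightarrow> 1 \<notin> W"
      unfolding mem_m'_set_iff[OF W(1)] by blast
    have finW: "finite W"
      using W finite_subset by blast
    \<comment> \<open>As \<open>c\<close> lies strictly between 1 and \<open>a\<close>, \<open>a - 1\<close> differs from 1. Of the two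
      conditions on small elements inside and outside \<open>R\<close>, it witnesses the one that \<open>c\<close> does not.\<close>
    have pred: "a - 1 \<in> {2..<a}" "a \<in> {1..n}" "a \<noteq> 1" "a - 1 \<noteq> a" "a - 1 \<noteq> 1" "c \<noteq> a" "c \<noteq> 1"
      using a c by auto
    show ?thesis
    proof (cases "1 \<in> W")
      case True
      then have "(W, a) \<in> row_corner_pairs j n"
        using W a c pred unfolding row_corner_pairs_def by blast
      then show ?thesis
        using True a q_eq by (simp add: exchange_def)
    next
      case False
      let ?R = "insert 1 (W - {a})"
      have "card ?R = j"
        using W a False finW by (metis DiffD1 card_Suc_Diff1 card_insert_disjoint finite_Diff)
      moreover have "1 \<in> {1..n}"
        using a by auto
      ultimately have "(?R, a) \<in> row_corner_pairs j n"
        using W a c pred False unfolding row_corner_pairs_def by blast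
      moreover have "insert a (?R - {1}) = W" "a - 1 \<notin> ?R"
        using a False pred by auto
      then have "exchange (?R, a) = (W, a)"
        by (simp only: exchange_def prod.case if_False)
      moreover have "?back q = (?R, a)"
        using False q_eq by simp
      ultimately show ?thesis
        using q_eq by (simp only:)
    qed
  qed
  show ?thesis
    using to_S from_S by (intro bij_betw_byWitness[where f' = ?back]) blast+
qed

text \<open>By injectivity of \<open>T\<close>, the position of the box with entry \<open>a - 1\<close> is decided by whether
  \<open>a - 1\<close> belongs to the first row. If it does not, the box is in the first column, because the only
  other box \<open>(2,2)\<close> contains \<open>a\<close>. Dropping the entry of \<open>(1,1)\<close> from the row means dropping 1.\<close>

lemma phi_eq_exchange:
  assumes j: "2 \<le> j" "j + 2 \<le> n" and T: "T \<in> Y_set j n"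
  shows "phi j n T = exchange (first_row j T, T (2, 2))"
proof -
  let ?D = "near_hook j n" and ?a = "T (2, 2)"
  define b where "b = box_B j n T"
  have inj: "inj_on T ?D" and img: "T ` ?D = {1..n}" and row: "strict_mono_on {1..j} (\<lambda>k. T (1, k))"
    using T unfolding Y_set_iff[OF j] by (auto simp: bij_betw_def)
  have T11: "T (1, 1) = 1" and "(first_row j T, ?a) \<in> row_corner_pairs j n"
    using tableau_facts[OF j T] by auto
  then have a: "?a - 1 \<in> {1..n}" "?a - 1 \<noteq> ?a"
    by (auto simp: row_corner_pairs_def)
  then have "?a - 1 \<in> T ` ?D"
    using img by simp
  then have b: "b \<in> ?D" "T b = ?a - 1"
    unfolding b_def box_B_def young_diagram_shape_j21[OF j] a_of_def
    by (rule inv_into_into, rule f_inv_into_f)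
  have in_row: "fst b = 1 \<longleftrightarrow> ?a - 1 \<in> first_row j T"
  proof
    assume "fst b = 1"
    then have "snd b \<in> {1..j}" "b = (1, snd b)"
      using b j by auto
    then have "T b \<in> first_row j T"
      unfolding first_row_def by (metis image_eqI)
    then show "?a - 1 \<in> first_row j T"
      using b by simp
  next
    assume "?a - 1 \<in> first_row j T"
    then obtain k where "k \<in> {1..j}" "T b = T (1, k)"
      using b by (auto simp: first_row_def)
    then have "b = (1, k)"
      using b by (intro inj_onD[OF inj]) auto
    then show "fst b = 1" by simp
  qed
  have in_col: "snd b = 1" if "fst b \<noteq> 1"
    using b a that by auto
  have "first_row j T - {1} = {T (1, i) |i. 2 \<le> i \<and> i \<le> j}"
  proof (intro equalityI subsetI)
    fix x assume "x \<in> first_row j T - {1}"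
    then obtain k where k: "k \<in> {1..j}" "x = T (1, k)" "x \<noteq> 1"
      by (auto simp: first_row_def)
    with T11 have "k \<noteq> 1"
      by auto
    with k show "x \<in> {T (1, i) |i. 2 \<le> i \<and> i \<le> j}"
      by force
  next
    fix x assume "x \<in> {T (1, i) |i. 2 \<le> i \<and> i \<le> j}"
    then obtain i where i: "2 \<le> i" "i \<le> j" "x = T (1, i)"
      by blast
    then have "T (1, 1) < T (1, i)"
      using strict_mono_onD[OF row, of 1 i] by auto
    with i T11 show "x \<in> first_row j T - {1}"
      by (auto simp: first_row_def)
  qed
  moreover have "first_row j T = {T (1, i) |i. 1 \<le> i \<and> i \<le> j}"
    by (auto simp: first_row_def)
  ultimately have "W_of j n T =
    (if fst b = 1 then first_row j T
     else if snd b = 1 then {?a} \<union> (first_row j T - {1}) else undefined)"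
    by (simp only: W_of_def b_def)
  then show ?thesis
    using in_row in_col by (cases "fst b = 1") (auto simp: phi_def a_of_def exchange_def)
qed

theorem theorem3p6:
  fixes n j :: nat
  assumes "n \<ge> 4" and "2 \<le> j" and "j \<le> n - 2"
  shows "bij_betw (phi j n) (Y_set j n) (S_set j n)"
proof -
  have j: "2 \<le> j" "j + 2 \<le> n"
    using assms by auto
  have "bij_betw (exchange \<circ> (\<lambda>T. (first_row j T, T (2, 2)))) (Y_set j n) (S_set j n)"
    by (rule bij_betw_trans[OF bij_betw_row_and_corner[OF j] bij_betw_exchange])
  then show ?thesis
    by (rule iffD1[OF bij_betw_cong, rotated]) (simp add: phi_eq_exchange[OF j])
qed

end
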